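(* Let $\mathbb{K}$ be a field and let $C \in (\mathbb{K}^m)^{\otimes k}$ be a symmetrically concise tensor whose stabilizer under congruence by $\mathrm{GL}(m,\mathbb{K})$ has cardinality $n$. Then, for any matrix $X\in\mathbb{K}^{d\times m}$ of rank $m$, there are exactly $n$ matrices $Y\in\mathbb{K}^{d\times m}$ with $[\![C;Y,Y,\ldots,Y]\!] = [\![C;X,X,\ldots,X]\!]$. In particular, if the stabilizer of $C$ under congruence by $\mathrm{GL}(m,\mathbb{K})$ is finite, then rank $m$ matrices $X$ are algebraically identifiable from the signature tensor $[\![C;X,X,\ldots,X]\!]$, i.e. for every $X \in \mathbb{K}^{d\times m}$ of rank $m$ the set of $Y\in\mathbb{K}^{d\times m}$ with $[\![C;Y,\ldots,Y]\!]=[\![C;X,\ldots,X]\!]$ is finite.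
   Context: For a tensor $C=(c_{\alpha_1\ldots\alpha_k}) \in (\mathbb{K}^m)^{\otimes k}$ and a matrix $X=(x_{ij}) \in \mathbb{K}^{d\times m}$, the tensor $[\![C;X,\ldots,X]\!] \in (\mathbb{K}^d)^{\otimes k}$ has entries $$[\![C;X,\ldots,X]\!]_{\beta_1\ldots\beta_k} = \sum_{\alpha_1,\ldots,\alpha_k=1}^m c_{\alpha_1\ldots\alpha_k}\, x_{\beta_1\alpha_1}\cdots x_{\beta_k\alpha_k}.$$ The stabilizer of $C$ under congruence by $\mathrm{GL}(m,\mathbb{K})$ is $\{Z \in \mathrm{GL}(m,\mathbb{K}) : [\![C;Z,\ldots,Z]\!] = C\}$. A tensor $C\in(\mathbb{K}^m)^{\otimes k}$ is symmetrically concise if there is no proper linear subspace $W\subsetneq\mathbb{K}^m$ with $C\in W^{\otimes k}$. Algebraic identifiability means that $X$ can be recovered from $[\![C;X,\ldots,X]\!]$ up to a finite list of choices. (In the paper $\mathbb{K}$ is usually $\mathbb{R}$ or $\mathbb{C}$.) *)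

theory Defs
  imports "HOL-Analysis.Analysis" "HOL-Library.Equipollence"
begin

text \<open>
  Vectors of length m are elements of \<open>'a ^ 'm\<close>, and d by m matrices are elements of
  \<open>'a ^ 'm ^ 'd\<close>, with the row index first in \<open>X $ i $ j\<close>. The k tensor positions are the
  elements of the finite type \<open>'k\<close>, so that a multi-index is a function \<open>'k \<Rightarrow> 'm\<close> and an
  element of the k-th tensor power of \<open>'a ^ 'm\<close> is given by its array of entries.
\<close>

type_synonym ('a, 'k, 'm) tensor = "('a, 'k \<Rightarrow> 'm) vec"

definition tensor_congruence ::
  "('a::field, 'k::finite, 'm::finite) tensor \<Rightarrow> 'a ^ 'm ^ 'd::finite \<Rightarrow> ('a, 'k, 'd) tensor"
  where "tensor_congruence C X =
    (\<chi> \<beta>. \<Sum>\<alpha>\<in>UNIV. C $ \<alpha> * (\<Prod>i\<in>UNIV. X $ \<beta> i $ \<alpha> i))"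

definition congruence_stabilizer ::
  "('a::field, 'k::finite, 'm::finite) tensor \<Rightarrow> ('a ^ 'm ^ 'm) set"
  where "congruence_stabilizer C = {Z. invertible Z \<and> tensor_congruence C Z = C}"

definition simple_tensor ::
  "('k::finite \<Rightarrow> 'a::field ^ 'm::finite) \<Rightarrow> ('a, 'k, 'm) tensor"
  where "simple_tensor w = (\<chi> \<alpha>. \<Prod>i\<in>UNIV. w i $ \<alpha> i)"

text \<open>
  For a subspace \<open>W\<close>, this is the k-th tensor power of \<open>W\<close>, regarded as a subspace of the k-th
  tensor power of the ambient space.
\<close>

definition tensor_power ::
  "('a::field ^ 'm::finite) set \<Rightarrow> ('a, 'k::finite, 'm) tensor set"
  where "tensor_power W = vec.span {simple_tensor w |w. \<forall>i. w i \<in> W}"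

definition symmetrically_concise ::
  "('a::field, 'k::finite, 'm::finite) tensor \<Rightarrow> bool"
  where "symmetrically_concise C \<longleftrightarrow>
    \<not> (\<exists>W. vec.subspace W \<and> W \<noteq> UNIV \<and> C \<in> tensor_power W)"

end

theory Submission
  imports Defs
begin

text \<open>
  Conciseness forces every \<open>Z\<close> with \<open>tensor_congruence C Z = C\<close> to be invertible, since \<open>C\<close> lies in
  the tensor power of the column space of \<open>Z\<close>. If \<open>tensor_congruence C Y = tensor_congruence C X\<close>
  and \<open>L\<close> is any left inverse of \<open>X\<close>, then \<open>L ** Y\<close> fixes \<open>C\<close>, so it is invertible. If some \<open>Y *v v\<close>
  were outside the column space of \<open>X\<close>, then one could choose \<open>L\<close> with \<open>L *v (Y *v v) = 0\<close>, which
  contradicts invertibility. Hence \<open>Y = X ** (L ** Y)\<close>, and \<open>Z \<mapsto> X ** Z\<close> is a bijection from the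
  stabilizer onto the fibre of \<open>X\<close>.
\<close>

lemma tensor_congruence_mult:
  fixes C :: "('a::field, 'k::finite, 'm::finite) tensor"
    and A :: "'a ^ 'm ^ 'd::finite" and B :: "'a ^ 'd ^ 'e::finite"
  shows "tensor_congruence (tensor_congruence C A) B = tensor_congruence C (B ** A)"
proof -
  have "(\<Sum>\<beta>\<in>UNIV. (\<Sum>\<alpha>\<in>UNIV. C $ \<alpha> * (\<Prod>i\<in>UNIV. A $ \<beta> i $ \<alpha> i)) * (\<Prod>i\<in>UNIV. B $ \<gamma> i $ \<beta> i))
      = (\<Sum>\<alpha>\<in>UNIV. C $ \<alpha> * (\<Prod>i\<in>UNIV. \<Sum>j\<in>UNIV. B $ \<gamma> i $ j * A $ j $ \<alpha> i))" for \<gamma> :: "'k \<Rightarrow> 'e"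
  proof -
    have "(\<Sum>\<beta>\<in>UNIV. (\<Sum>\<alpha>\<in>UNIV. C $ \<alpha> * (\<Prod>i\<in>UNIV. A $ \<beta> i $ \<alpha> i)) * (\<Prod>i\<in>UNIV. B $ \<gamma> i $ \<beta> i))
        = (\<Sum>\<beta>\<in>UNIV. \<Sum>\<alpha>\<in>UNIV. C $ \<alpha> * (\<Prod>i\<in>UNIV. B $ \<gamma> i $ \<beta> i * A $ \<beta> i $ \<alpha> i))"
      by (simp add: sum_distrib_left prod.distrib mult_ac)
    also have "\<dots> = (\<Sum>\<alpha>\<in>UNIV. C $ \<alpha> * (\<Sum>\<beta>\<in>UNIV. \<Prod>i\<in>UNIV. B $ \<gamma> i $ \<beta> i * A $ \<beta> i $ \<alpha> i))"
      by (subst sum.swap) (simp add: sum_distrib_left)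
    \<comment> \<open>Distributivity: expanding the product over \<open>i\<close> of sums over
      \<open>j\<close> chooses one \<open>j\<close> for each \<open>i\<close>, that is, a
      multi-index \<open>\<beta>\<close>.\<close>
    also have "\<dots> = (\<Sum>\<alpha>\<in>UNIV. C $ \<alpha> * (\<Prod>i\<in>UNIV. \<Sum>j\<in>UNIV. B $ \<gamma> i $ j * A $ j $ \<alpha> i))"
      by (subst prod_sum_PiE) auto
    finally show ?thesis .
  qed
  then show ?thesis
    by (simp add: tensor_congruence_def matrix_matrix_mult_def)
qed

lemma tensor_congruence_mat_1:
  fixes C :: "('a::field, 'k::finite, 'm::finite) tensor"
  shows "tensor_congruence C (mat 1) = C"
proof -
  have mat_1: "(\<Prod>i\<in>UNIV. (mat 1 :: 'a ^ 'm ^ 'm) $ \<beta> i $ \<alpha> i) = (if \<alpha> = \<beta> then 1 else 0)"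
    for \<alpha> \<beta> :: "'k \<Rightarrow> 'm"
  proof (cases "\<alpha> = \<beta>")
    case False
    then obtain i where "\<beta> i \<noteq> \<alpha> i"
      by force
    then show ?thesis
      using False by (auto simp: mat_def intro!: prod_zero)
  qed (simp add: mat_def)
  show ?thesis
    by (simp add: tensor_congruence_def vec_eq_iff mat_1 if_distrib cong: if_cong)
qed

text \<open>The entries of \<open>C\<close> serve as coefficients of a linear combination of simple
  tensors built from columns of \<open>A\<close>.\<close>

lemma tensor_congruence_in_tensor_power_range:
  fixes C :: "('a::field, 'k::finite, 'm::finite) tensor" and A :: "'a ^ 'm ^ 'd::finite"
  shows "tensor_congruence C A \<in> tensor_power (range ((*v) A))"
proof -
  have "column j A = A *v axis j 1" for j
    by (simp add: matrix_vector_mult_def axis_def column_def if_distrib cong: if_cong)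
  then have "column j A \<in> range ((*v) A)" for j
    by simp
  then have "simple_tensor (\<lambda>i. column (\<alpha> i) A) \<in> tensor_power (range ((*v) A))" for \<alpha> :: "'k \<Rightarrow> 'm"
    unfolding tensor_power_def by (intro vec.span_base) blast
  then have "(\<Sum>\<alpha>\<in>UNIV. C $ \<alpha> *s simple_tensor (\<lambda>i. column (\<alpha> i) A)) \<in> tensor_power (range ((*v) A))"
    unfolding tensor_power_def by (intro vec.span_sum vec.span_scale)
  moreover have "tensor_congruence C A = (\<Sum>\<alpha>\<in>UNIV. C $ \<alpha> *s simple_tensor (\<lambda>i. column (\<alpha> i) A))"
    by (simp add: tensor_congruence_def simple_tensor_def column_def vec_eq_iff)
  ultimately show ?thesis
    by simp
qed

lemma symmetrically_concise_fixed_imp_invertible: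
  assumes "symmetrically_concise C" "tensor_congruence C Z = C"
  shows "invertible Z"
proof -
  have "vec.subspace (range ((*v) Z))"
    by (intro vec.linear_subspace_image matrix_vector_mul_linear_gen vec.subspace_UNIV)
  then have "surj ((*v) Z)"
    using assms tensor_congruence_in_tensor_power_range[of C Z]
    unfolding symmetrically_concise_def by auto
  then show ?thesis
    by (simp add: invertible_right_inverse matrix_right_invertible_surjective)
qed

text \<open>\<open>rank\<close> is the dimension of the row space, so full column rank means that
  the rows span everything.\<close>

lemma full_column_rank_left_inverse:
  fixes X :: "'a::field ^ 'm ^ 'd"
  assumes "rank X = CARD('m)"
  obtains L where "L ** X = mat 1"
proof -
  have "vec.span (rows X) = UNIV"
    using assms vec.dim_eq_full[of "rows X"]
    by (simp add: row_rank_def_gen vec.dimension_def card_cart_basis)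
  then show ?thesis
    using that matrix_left_invertible_span_rows_gen by blast
qed

lemma matrix_maps_nonzero_vector_anywhere:
  fixes w :: "'a::field ^ 'd" and z :: "'a ^ 'm"
  assumes "w \<noteq> 0"
  obtains M where "M *v w = z"
proof -
  obtain a where a: "w $ a \<noteq> 0"
    using assms by (auto simp: vec_eq_iff)
  \<comment> \<open>All columns vanish except column \<open>a\<close>, which is \<open>z\<close>
    divided by the nonzero entry \<open>w $ a\<close>.\<close>
  have "(\<chi> i j. if j = a then z $ i / w $ a else 0) *v w = z"
    using a by (simp add: matrix_vector_mult_def vec_eq_iff if_distrib[of "\<lambda>x. x * _"] cong: if_cong)
  then show ?thesis
    by (rule that)
qed

lemma symmetrically_concise_same_congruence_factor:
  fixes C :: "('a::field, 'k::finite, 'm::finite) tensor" and X Y :: "'a ^ 'm ^ 'd::finite"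
  assumes C: "symmetrically_concise C"
    and L: "L ** X = mat 1"
    and Y: "tensor_congruence C Y = tensor_congruence C X"
  shows "Y = X ** (L ** Y)"
proof (rule ccontr)
  assume "Y \<noteq> X ** (L ** Y)"
  then obtain v where v: "Y *v v - X *v (L *v (Y *v v)) \<noteq> 0"
    by (auto simp: matrix_eq matrix_vector_mul_assoc matrix_mul_assoc)
  \<comment> \<open>\<open>X ** L\<close> is a projection onto the column space of \<open>X\<close>;
    \<open>?w\<close> is the part of \<open>Y *v v\<close> that it misses.\<close>
  let ?w = "Y *v v - X *v (L *v (Y *v v))"
  obtain M where M: "M *v ?w = - (L *v (Y *v v))"
    using matrix_maps_nonzero_vector_anywhere[OF v] .
  \<comment> \<open>Since \<open>mat 1 - X ** L\<close> kills the columns of \<open>X\<close>,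
    \<open>?L\<close> is a left inverse of \<open>X\<close> for any \<open>M\<close>. The chosen
    \<open>M\<close> makes the correction cancel \<open>L *v (Y *v v)\<close>.\<close>
  let ?L = "L + M ** (mat 1 - X ** L)"
  have L_eq: "?L *v u = L *v u + M *v (u - X *v (L *v u))" for u
    by (simp add: matrix_vector_mult_add_rdistrib matrix_vector_mult_diff_rdistrib
        flip: matrix_vector_mul_assoc)
  have "?L ** X = mat 1"
    unfolding matrix_eq
  proof
    fix u
    have "L *v (X *v u) = u"
      by (simp add: matrix_vector_mul_assoc L)
    then show "(?L ** X) *v u = mat 1 *v u"
      by (simp add: L_eq flip: matrix_vector_mul_assoc)
  qed
  \<comment> \<open>Applying \<open>?L\<close> to the common tensor of \<open>Y\<close> and
    \<open>X\<close> gives \<open>tensor_congruence C (?L ** X)\<close>, which is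
    \<open>C\<close>.\<close>
  then have "tensor_congruence C (?L ** Y) = C"
    by (metis Y tensor_congruence_mult tensor_congruence_mat_1)
  then obtain Z' where Z': "Z' ** (?L ** Y) = mat 1"
    using symmetrically_concise_fixed_imp_invertible[OF C] invertible_left_inverse by blast
  have "(?L ** Y) *v v = 0"
    using M by (simp add: L_eq flip: matrix_vector_mul_assoc)
  then have "v = 0"
    by (metis Z' matrix_vector_mul_assoc matrix_vector_mul_lid matrix_vector_mult_0_right)
  with v show False
    by simp
qed

text \<open>The inverse map is left multiplication by a left inverse of \<open>X\<close>; that it
  lands in the stabilizer and is undone by \<open>X\<close> both rest on conciseness.\<close>

lemma symmetrically_concise_bij_betw_stabilizer_fibre:
  fixes C :: "('a::field, 'k::finite, 'm::finite) tensor" and X :: "'a ^ 'm ^ 'd::finite"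
  assumes C: "symmetrically_concise C" and "rank X = CARD('m)"
  shows "bij_betw ((**) X) (congruence_stabilizer C)
           {Y. tensor_congruence C Y = tensor_congruence C X}"
proof -
  obtain L where L: "L ** X = mat 1"
    using full_column_rank_left_inverse[OF assms(2)] .
  have "L ** Y \<in> congruence_stabilizer C"
    if "tensor_congruence C Y = tensor_congruence C X" for Y
  proof -
    have "tensor_congruence C (L ** Y) = C"
      by (metis that L tensor_congruence_mult tensor_congruence_mat_1)
    then show ?thesis
      using symmetrically_concise_fixed_imp_invertible[OF C]
      by (auto simp: congruence_stabilizer_def)
  qed
  moreover have "L ** (X ** Z) = Z" for Z :: "'a ^ 'm ^ 'm"
    by (simp add: matrix_mul_assoc L)
  moreover have "tensor_congruence C (X ** Z) = tensor_congruence C X"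
    if "Z \<in> congruence_stabilizer C" for Z
    using that by (simp add: congruence_stabilizer_def flip: tensor_congruence_mult)
  moreover have "X ** (L ** Y) = Y" if "tensor_congruence C Y = tensor_congruence C X" for Y
    using symmetrically_concise_same_congruence_factor[OF C L that] by simp
  ultimately show ?thesis
    by (intro bij_betw_byWitness[where f' = "(**) L"]) auto
qed

theorem corollary4p3:
  fixes C :: "('a::field, 'k::finite, 'm::finite) tensor"
  assumes "symmetrically_concise C"
  shows "(\<forall>n. finite (congruence_stabilizer C) \<and> card (congruence_stabilizer C) = n \<longrightarrow>
            (\<forall>X :: 'a ^ 'm ^ 'd::finite. rank X = CARD('m) \<longrightarrow>
              finite {Y :: 'a ^ 'm ^ 'd. tensor_congruence C Y = tensor_congruence C X} \<and>
              card {Y :: 'a ^ 'm ^ 'd. tensor_congruence C Y = tensor_congruence C X} = n)) \<and>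
         (\<forall>X :: 'a ^ 'm ^ 'd. rank X = CARD('m) \<longrightarrow>
            {Y :: 'a ^ 'm ^ 'd. tensor_congruence C Y = tensor_congruence C X}
              \<approx> congruence_stabilizer C) \<and>
         (finite (congruence_stabilizer C) \<longrightarrow>
            (\<forall>X :: 'a ^ 'm ^ 'd. rank X = CARD('m) \<longrightarrow>
              finite {Y :: 'a ^ 'm ^ 'd. tensor_congruence C Y = tensor_congruence C X}))"
proof -
  \<comment> \<open>This single bijection yields all three claims; the equipollence also covers an
    infinite stabilizer.\<close>
  have bij: "bij_betw ((**) X) (congruence_stabilizer C)
      {Y. tensor_congruence C Y = tensor_congruence C X}"
    if "rank X = CARD('m)" for X :: "'a ^ 'm ^ 'd"
    using symmetrically_concise_bij_betw_stabilizer_fibre[OF assms that] .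
  show ?thesis
  proof (intro conjI allI impI)
    fix X :: "'a ^ 'm ^ 'd"
    assume "rank X = CARD('m)"
    then show "{Y :: 'a ^ 'm ^ 'd. tensor_congruence C Y = tensor_congruence C X}
        \<approx> congruence_stabilizer C"
      using bij eqpoll_def eqpoll_sym by blast
  qed (use bij bij_betw_finite bij_betw_same_card in \<open>blast, metis+\<close>)
qed

end
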